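(* Let $d\in\mathbb{R}^2$, $d\ne 0$. (i) If $d\in\mathrm{int}(C_\emptyset)$, then for any $\beta\in\mathbb{R}^2$ and arbitrarily small $\epsilon\in(0,1)$ there exists $n(\epsilon)$ such that for all $n\ge n(\epsilon)$ there exists $r(\epsilon,n)$ such that, for all $r\ge r(\epsilon,n)$, the empty graph on $n$ vertices has probability at least $1-\epsilon$ under $P_{n,\beta+rd}$. (ii) If $d\in\mathrm{int}(C_{\mathrm{complete}})$, then for any $\beta\in\mathbb{R}^2$ and arbitrarily small $\epsilon\in(0,1)$ there exists $n(\epsilon)$ such that for all $n\ge n(\epsilon)$ there exists $r(\epsilon,n)$ such that, for all $r\ge r(\epsilon,n)$, the complete graph on $n$ vertices has probability at least $1-\epsilon$ under $P_{n,\beta+rd}$. (iii) If $d\in\mathrm{int}(C_L)$, then for any $\beta\in\mathbb{R}^2$ and arbitrarily small $\epsilon,\eta\in(0,1)$ there exists $n(\epsilon,\eta)$ such that for all $n\ge n(\epsilon,\eta)$ there exists $r(\epsilon,\eta,n)$ such that, for all $r\ge r(\epsilon,\eta,n)$, the set of graphs in $\mathcal{G}_n$ whose normalized edge-degeneracy vector $t(G)$ is within $\eta$ of $\alpha(d)$ has probability at least $1-\epsilon$ under $P_{n,\beta+rd}$. (iv) If $d\in\mathrm{int}(C_U)$, then for any $\beta\in\mathbb{R}^2$ and arbitrarily small $\epsilon,\eta\in(0,1)$ there exists $n(\epsilon,\eta)$ such that for all $n\ge n(\epsilon,\eta)$ there exists $r(\epsilon,\eta,n)$ such that, for all $r\ge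 r(\epsilon,\eta,n)$, the set of graphs in $\mathcal{G}_n$ whose normalized edge-degeneracy vector $t(G)$ is within $\eta$ of $\alpha(d)$ has probability at least $1-\epsilon$ under $P_{n,\beta+rd}$.
   Context: $\mathcal{G}_n$ ($n\ge 2$) is the set of labeled, undirected simple graphs on $n$ vertices; $E(G)$ is the number of edges of $G$. The $k$-core of $G$ is its maximal subgraph with minimum degree at least $k$; $\mathrm{degen}(G)$ is the maximum $k$ for which the $k$-core of $G$ is non-empty. The normalized edge-degeneracy vector of $G\in\mathcal{G}_n$ is $t(G)=\left(E(G)/\binom{n}{2},\ \mathrm{degen}(G)/(n-1)\right)$. The edge-degeneracy model on $\mathcal{G}_n$ is the exponential family $P_{n,\theta}(G)=\exp\{\langle\theta,t(G)\rangle-\psi_n(\theta)\}$, $\theta\in\mathbb{R}^2$, where $\psi_n(\theta)=\log\sum_{G\in\mathcal{G}_n}e^{\langle\theta,t(G)\rangle}$. Let $L(x)=1-\sqrt{1-x}$, $U(x)=\sqrt{x}$ on $[0,1]$ and $\mathcal{P}=\{(x,y)\in[0,1]^2 : L(x)\le y\le U(x)\}$, a compact convex set (it is the closure of the set of all $t(G)$ over all $n$ and $G\in\mathcal{G}_n$). With $\mathrm{cone}(A)$ the set of non-negative linear combinations of elements of $A$, define $$C_\emptyset=\mathrm{cone}\{(1,-2),(-1,0)\},\quad C_{\mathrm{complete}}=\mathrm{cone}\{(1,0),(-1,2)\},$$ $$C_U=\mathrm{cone}\{(-1,0),(-1,2)\},\quad C_L=\mathrm{cone}\{(1,0),(1,-2)\}.$$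 $\mathrm{int}$ denotes topological interior in $\mathbb{R}^2$. For $d\neq 0$, $\alpha(d)$ is the point on the boundary of $\mathcal{P}$ to which $d$ is an (outer) normal direction, i.e. the unique maximizer of $\langle d,\cdot\rangle$ over $\mathcal{P}$. For $d\in\mathrm{int}(C_L)$, after positive rescaling to $d=(1,a)$, $\alpha(d)$ is the point $(x,L(x))$ with $L'(x)=-1/a$; for $d\in\mathrm{int}(C_U)$, after positive rescaling to $d=(-1,a)$, $\alpha(d)$ is the point $(x,U(x))$ with $U'(x)=1/a$. *)

theory Defs
  imports "HOL-Probability.Probability"
begin

section \<open>Labeled simple graphs, cores and degeneracy\<close>

text \<open>A graph is a pair of a vertex set and an edge set; an edge is a two-element set of vertices.\<close>

type_synonym graph = "nat set \<times> nat set set"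

abbreviation verts :: "graph \<Rightarrow> nat set" where "verts \<equiv> fst"
abbreviation edges :: "graph \<Rightarrow> nat set set" where "edges \<equiv> snd"

definition all_edges :: "nat set \<Rightarrow> nat set set" where
  "all_edges V = {e. e \<subseteq> V \<and> card e = 2}"

definition graphs :: "nat \<Rightarrow> graph set" where
  "graphs n = {({..<n}, E) | E. E \<subseteq> all_edges {..<n}}"

definition empty_graph :: "nat \<Rightarrow> graph" where
  "empty_graph n = ({..<n}, {})"

definition complete_graph :: "nat \<Rightarrow> graph" where
  "complete_graph n = ({..<n}, all_edges {..<n})"

definition degree :: "graph \<Rightarrow> nat \<Rightarrow> nat" where
  "degree G v = card {e \<in> edges G. v \<in> e}"

definition subgraph :: "graph \<Rightarrow> graph \<Rightarrow> bool" where
  "subgraph H G \<longleftrightarrow>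
     verts H \<subseteq> verts G \<and> edges H \<subseteq> edges G \<and> edges H \<subseteq> all_edges (verts H)"

text \<open>The graph without vertices has minimum degree at least \<open>k\<close> for every \<open>k\<close>, so the
  \<open>k\<close>-core always exists but may have no vertices.\<close>

definition min_degree_ge :: "nat \<Rightarrow> graph \<Rightarrow> bool" where
  "min_degree_ge k H \<longleftrightarrow> (\<forall>v \<in> verts H. k \<le> degree H v)"

definition is_k_core :: "nat \<Rightarrow> graph \<Rightarrow> graph \<Rightarrow> bool" where
  "is_k_core k G H \<longleftrightarrow>
     subgraph H G \<and> min_degree_ge k H \<and>
     (\<forall>H'. subgraph H' G \<and> min_degree_ge k H' \<and> subgraph H H' \<longrightarrow> H' = H)"

definition k_core :: "nat \<Rightarrow> graph \<Rightarrow> graph" where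
  "k_core k G = (THE H. is_k_core k G H)"

definition degen :: "graph \<Rightarrow> nat" where
  "degen G = Max {k. verts (k_core k G) \<noteq> {}}"

lemma finite_graphs: "finite (graphs n)"
proof -
  have "graphs n \<subseteq> {{..<n}} \<times> Pow (Pow {..<n})"
    by (auto simp: graphs_def all_edges_def)
  then show ?thesis by (rule finite_subset) simp
qed

lemma empty_graph_in_graphs: "empty_graph n \<in> graphs n"
  by (simp add: graphs_def empty_graph_def)

lemma complete_graph_in_graphs: "complete_graph n \<in> graphs n"
  by (simp add: graphs_def complete_graph_def)

lemma degree_mono:
  assumes "edges H \<subseteq> edges K" "finite (edges K)"
  shows "degree H v \<le> degree K v"
  unfolding degree_def using assms by (intro card_mono) auto

lemma ex1_k_core:
  assumes G: "G \<in> graphs n"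
  shows "\<exists>!H. is_k_core k G H"
proof -
  define S where "S = {H. subgraph H G \<and> min_degree_ge k H}"
  define K :: graph where "K = (\<Union>(verts ` S), \<Union>(edges ` S))"
  have finE: "finite (edges G)"
  proof (rule finite_subset)
    show "edges G \<subseteq> Pow {..<n}" using G by (auto simp: graphs_def all_edges_def)
  qed simp
  have sub: "subgraph H K" if "H \<in> S" for H
    using that unfolding K_def S_def subgraph_def by auto
  have subK: "subgraph K G"
    unfolding subgraph_def
  proof (intro conjI)
    show "verts K \<subseteq> verts G" "edges K \<subseteq> edges G"
      by (auto simp: K_def S_def subgraph_def)
    show "edges K \<subseteq> all_edges (verts K)"
    proof
      fix e assume "e \<in> edges K"
      then obtain H where H: "H \<in> S" "e \<in> edges H" by (auto simp: K_def)
      then have "e \<in> all_edges (verts H)" by (auto simp: S_def subgraph_def)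
      moreover have "verts H \<subseteq> verts K" using sub[OF H(1)] by (simp add: subgraph_def)
      ultimately show "e \<in> all_edges (verts K)" by (auto simp: all_edges_def)
    qed
  qed
  have finK: "finite (edges K)"
    using subK finE by (auto simp: subgraph_def intro: finite_subset)
  have "min_degree_ge k K"
    unfolding min_degree_ge_def
  proof
    fix v assume "v \<in> verts K"
    then obtain H where H: "H \<in> S" "v \<in> verts H" by (auto simp: K_def)
    then have "k \<le> degree H v" by (auto simp: S_def min_degree_ge_def)
    also have "\<dots> \<le> degree K v"
      using sub[OF H(1)] finK by (intro degree_mono) (auto simp: subgraph_def)
    finally show "k \<le> degree K v" .
  qed
  with subK have K: "K \<in> S" by (simp add: S_def)
  have eq: "H = K" if "H \<in> S" "subgraph K H" for H
    using that(2) sub[OF that(1)] by (intro prod_eqI subset_antisym) (auto simp: subgraph_def)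
  have "is_k_core k G K"
    using K eq unfolding is_k_core_def S_def by blast
  moreover have "H = K" if "is_k_core k G H" for H
  proof -
    have "H \<in> S" using that by (simp add: is_k_core_def S_def)
    then show ?thesis using that K sub unfolding is_k_core_def S_def by blast
  qed
  ultimately show ?thesis by blast
qed

section \<open>The edge-degeneracy model\<close>

definition edge_degen_vec :: "graph \<Rightarrow> real \<times> real" where
  "edge_degen_vec G =
     (let n = card (verts G)
      in (real (card (edges G)) / real (n choose 2), real (degen G) / (real n - 1)))"

definition log_partition :: "nat \<Rightarrow> real \<times> real \<Rightarrow> real" where
  "log_partition n \<theta> = ln (\<Sum>G\<in>graphs n. exp (\<theta> \<bullet> edge_degen_vec G))"

definition ed_mass :: "nat \<Rightarrow> real \<times> real \<Rightarrow> graph \<Rightarrow> real" where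
  "ed_mass n \<theta> G = exp (\<theta> \<bullet> edge_degen_vec G - log_partition n \<theta>)"

definition ed_model :: "nat \<Rightarrow> real \<times> real \<Rightarrow> graph measure" where
  "ed_model n \<theta> = point_measure (graphs n) (\<lambda>G. ennreal (ed_mass n \<theta> G))"

lemma prob_space_ed_model: "prob_space (ed_model n \<theta>)"
proof -
  let ?Z = "\<Sum>G\<in>graphs n. exp (\<theta> \<bullet> edge_degen_vec G)"
  have "?Z > 0"
    using empty_graph_in_graphs[of n] by (intro sum_pos finite_graphs) auto
  then have "(\<Sum>G\<in>graphs n. ed_mass n \<theta> G) = 1"
    by (simp add: ed_mass_def log_partition_def exp_diff sum_divide_distrib[symmetric])
  then have "(\<Sum>G\<in>graphs n. ennreal (ed_mass n \<theta> G)) = 1"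
    by (subst sum_ennreal) (auto simp: ed_mass_def)
  then show ?thesis
    unfolding ed_model_def by (intro prob_space_point_measure finite_graphs) auto
qed

section \<open>The limit region, its normal directions and the cones\<close>

definition L_curve :: "real \<Rightarrow> real" where "L_curve x = 1 - sqrt (1 - x)"
definition U_curve :: "real \<Rightarrow> real" where "U_curve x = sqrt x"

definition limit_region :: "(real \<times> real) set" where
  "limit_region = {(x, y). x \<in> {0..1} \<and> y \<in> {0..1} \<and> L_curve x \<le> y \<and> y \<le> U_curve x}"

text \<open>The region is compact and strictly convex, so for \<open>d \<noteq> 0\<close> there is exactly one boundary
  point with outer normal \<open>d\<close>; for \<open>d = 0\<close> the description is not unique.\<close>

definition alpha :: "real \<times> real \<Rightarrow> real \<times> real" where
  "alpha d = (THE p. p \<in> frontier limit_region \<and> p \<in> limit_region \<and>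
                     (\<forall>q \<in> limit_region. d \<bullet> q \<le> d \<bullet> p))"

text \<open>The library predicate \<open>cone\<close> only asks for closure under scaling, so \<open>cone hull\<close> would be
  a union of rays.\<close>

definition cone_gen :: "(real \<times> real) set \<Rightarrow> (real \<times> real) set" where
  "cone_gen A = {(\<Sum>a\<in>F. c a *\<^sub>R a) | F c. finite F \<and> F \<subseteq> A \<and> (\<forall>a\<in>F. 0 \<le> (c a :: real))}"

definition C_empty :: "(real \<times> real) set" where "C_empty = cone_gen {(1, -2), (-1, 0)}"
definition C_complete :: "(real \<times> real) set" where "C_complete = cone_gen {(1, 0), (-1, 2)}"
definition C_U :: "(real \<times> real) set" where "C_U = cone_gen {(-1, 0), (-1, 2)}"
definition C_L :: "(real \<times> real) set" where "C_L = cone_gen {(1, 0), (1, -2)}"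

end

theory Submission
  imports Defs
begin

text \<open>For a fixed number \<open>n\<close> of vertices the sample space is finite, so along a ray
  \<open>\<beta> + r d\<close> all mass drifts, as \<open>r\<close> grows, to the graphs maximizing
  \<open>\<langle>d, t(G)\<rangle>\<close>, whatever \<open>\<beta>\<close> is (lemma \<open>ray_concentration\<close>).  It remains to locate
  these maximizers.

  A graph of degeneracy \<open>D\<close> contains a subgraph with at least \<open>D + 1\<close> vertices of degree at
  least \<open>D\<close>, hence has at least \<open>D (D + 1) / 2\<close> edges; deleting vertices of degree at most
  \<open>D\<close> one by one shows that it has at most \<open>D n - D (D + 1) / 2\<close> edges.  After
  normalization both bounds imply that \<open>t(G)\<close> lies in the region \<open>y\<^sup>2 \<le> x\<close>,
  \<open>(1 - y)\<^sup>2 \<le> 1 - x\<close> between the two curves, for every \<open>n \<ge> 2\<close> and not only in the limit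
  (lemma \<open>edge_degen_vec_in_limit_region\<close>).

  In coordinates \<open>d = (a, b)\<close> the interiors of the four cones are contained in the four regions
  cut out by the signs of \<open>b\<close> and \<open>2 a + b\<close>.  Between the two curves \<open>x / 2 \<le> y\<close> and
  \<open>y \<le> (1 + x) / 2\<close>, bounds given by the tangents to the curves at \<open>(0, 0)\<close> and
  \<open>(1, 1)\<close>; so in the first two cases the respective corner is the unique maximum over the
  region, and only the empty, respectively the complete, graph attains it.

  In the other two cases completing the square shows that the maximum over the region is attained
  at one point only, in the relative interior of a curve (lemma \<open>parabola_exposed\<close>).  By
  compactness, points further than \<open>\<eta>\<close> from it fall short of the maximum by a fixed amount.
  A clique on about \<open>c n\<close> vertices together with isolated vertices, respectively the complement
  of such a graph, has a value of \<open>\<langle>d, t(G)\<rangle>\<close> that tends to the maximum.  Hence, for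
  large \<open>n\<close>, no graph with \<open>t(G)\<close> further than \<open>\<eta>\<close> from \<open>\<alpha>(d)\<close> is a maximizer.\<close>

section \<open>Degeneracy and subgraphs of large minimum degree\<close>

lemma graphs_iff: "G \<in> graphs n \<longleftrightarrow> verts G = {..<n} \<and> edges G \<subseteq> all_edges {..<n}"
  by (cases G) (auto simp: graphs_def)

lemma finite_all_edges: "finite V \<Longrightarrow> finite (all_edges V)"
  unfolding all_edges_def by simp

lemma card_all_edges: "finite V \<Longrightarrow> card (all_edges V) = card V choose 2"
  unfolding all_edges_def by (rule n_subsets)

lemma real_choose_two: "real (n choose 2) = real n * (real n - 1) / 2"
proof (induction n)
  case (Suc n)
  have "Suc n choose 2 = n + (n choose 2)" by (simp add: numeral_2_eq_2)
  then show ?case using Suc by (simp add: field_simps)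
qed simp

lemma degree_eq_card_neighbours:
  assumes "edges H \<subseteq> all_edges W"
  shows "degree H v = card {w. w \<noteq> v \<and> {v, w} \<in> edges H}"
proof -
  have "{e \<in> edges H. v \<in> e} = (\<lambda>w. {v, w}) ` {w. w \<noteq> v \<and> {v, w} \<in> edges H}"
  proof (intro equalityI subsetI)
    fix e assume "e \<in> {e \<in> edges H. v \<in> e}"
    then have e: "e \<in> edges H" "v \<in> e" "card e = 2"
      using assms by (auto simp: all_edges_def)
    from e(3) obtain a b where "e = {a, b}" "a \<noteq> b" by (auto simp: card_2_iff)
    with e show "e \<in> (\<lambda>w. {v, w}) ` {w. w \<noteq> v \<and> {v, w} \<in> edges H}"
      by (auto simp: insert_commute)
  qed auto
  moreover have "inj_on (\<lambda>w. {v, w}) {w. w \<noteq> v \<and> {v, w} \<in> edges H}"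
    by (auto simp: inj_on_def doubleton_eq_iff)
  ultimately show ?thesis unfolding degree_def by (simp add: card_image)
qed

lemma degree_less_card_verts:
  assumes "edges H \<subseteq> all_edges (verts H)" "finite (verts H)" "v \<in> verts H"
  shows "degree H v < card (verts H)"
proof -
  have "{w. w \<noteq> v \<and> {v, w} \<in> edges H} \<subset> verts H"
    using assms by (auto simp: all_edges_def)
  then show ?thesis
    unfolding degree_eq_card_neighbours[OF assms(1)] by (rule psubset_card_mono[OF assms(2)])
qed

lemma subgraph_finite:
  assumes "G \<in> graphs n" "subgraph H G"
  shows "finite (verts H)" "finite (edges H)" "verts H \<subseteq> {..<n}"
proof -
  show v: "verts H \<subseteq> {..<n}" using assms by (simp add: graphs_iff subgraph_def)
  then show f: "finite (verts H)" by (rule finite_subset) simp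
  show "finite (edges H)"
    using assms(2) finite_all_edges[OF f] by (auto simp: subgraph_def intro: finite_subset)
qed

text \<open>A \<open>k\<close>-core is defined by maximality.  As the graph is finite, every subgraph of minimum
  degree at least \<open>k\<close> extends to a maximal one, and by uniqueness that one is the core.\<close>

lemma subgraph_k_core:
  assumes G: "G \<in> graphs n" and H: "subgraph H G" "min_degree_ge k H"
  shows "subgraph H (k_core k G)"
proof -
  define S where "S = {H'. subgraph H' G \<and> min_degree_ge k H' \<and> subgraph H H'}"
  let ?f = "\<lambda>H'. card (verts H') + card (edges H')"
  have "subgraph H H" using H by (simp add: subgraph_def)
  then have "H \<in> S" using H by (simp add: S_def)
  have finG: "finite (verts G)" "finite (edges G)"
    using subgraph_finite[OF G, of G] G by (auto simp: subgraph_def graphs_iff)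
  have bound: "?f H' \<le> ?f G" if "H' \<in> S" for H'
    using that finG by (auto simp: S_def subgraph_def intro!: add_mono card_mono)
  have "\<exists>K. K \<in> S \<and> (\<forall>H'. H' \<in> S \<longrightarrow> ?f H' \<le> ?f K)"
    by (rule ex_has_greatest_nat[of _ H _ "Suc (?f G)"])
      (use \<open>H \<in> S\<close> bound in \<open>simp_all only: less_Suc_eq_le, blast\<close>)
  then obtain K where K: "K \<in> S" and max: "\<forall>H'. H' \<in> S \<longrightarrow> ?f H' \<le> ?f K"
    by (elim exE conjE)
  have "is_k_core k G K"
    unfolding is_k_core_def
  proof (intro conjI allI impI)
    show "subgraph K G" "min_degree_ge k K" using K by (simp_all add: S_def)
    fix H' assume H': "subgraph H' G \<and> min_degree_ge k H' \<and> subgraph K H'"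
    moreover have "subgraph H K" using K by (simp add: S_def)
    ultimately have "H' \<in> S" unfolding S_def subgraph_def by blast
    then have le: "?f H' \<le> ?f K" by (rule max[rule_format])
    have fin: "finite (verts H')" "finite (edges H')"
      using subgraph_finite[OF G] H' by auto
    have sub: "verts K \<subseteq> verts H'" "edges K \<subseteq> edges H'"
      using H' by (simp_all add: subgraph_def)
    have "card (verts K) \<le> card (verts H')" "card (edges K) \<le> card (edges H')"
      by (intro card_mono fin sub)+
    with le have "card (verts K) = card (verts H')" "card (edges K) = card (edges H')"
      by linarith+
    then have "verts K = verts H'" "edges K = edges H'"
      using card_subset_eq[OF fin(1) sub(1)] card_subset_eq[OF fin(2) sub(2)] by simp_all
    then show "H' = K" by (simp add: prod_eq_iff)
  qed
  then have "k_core k G = K"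
    unfolding k_core_def using ex1_k_core[OF G] by (rule the1_equality[rotated])
  with K show ?thesis by (simp add: S_def)
qed

text \<open>This frees the degeneracy from cores: it is the largest \<open>k\<close> for which some
  nonempty subgraph has minimum degree at least \<open>k\<close>.\<close>

lemma k_core_nonempty_iff:
  assumes "G \<in> graphs n"
  shows "verts (k_core k G) \<noteq> {} \<longleftrightarrow>
    (\<exists>H. subgraph H G \<and> min_degree_ge k H \<and> verts H \<noteq> {})"
proof
  have "is_k_core k G (k_core k G)"
    unfolding k_core_def by (rule theI'[OF ex1_k_core[OF assms]])
  then have "subgraph (k_core k G) G \<and> min_degree_ge k (k_core k G)"
    unfolding is_k_core_def by (elim conjE, intro conjI)
  then show "\<exists>H. subgraph H G \<and> min_degree_ge k H \<and> verts H \<noteq> {}"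
    if "verts (k_core k G) \<noteq> {}" using that by (intro exI[of _ "k_core k G"]) simp
next
  assume "\<exists>H. subgraph H G \<and> min_degree_ge k H \<and> verts H \<noteq> {}"
  then obtain H where H: "subgraph H G" "min_degree_ge k H" "verts H \<noteq> {}" by (elim exE conjE)
  then show "verts (k_core k G) \<noteq> {}"
    using subgraph_k_core[OF assms H(1,2)] unfolding subgraph_def by auto
qed

text \<open>A vertex of degree \<open>k\<close> has \<open>k\<close> neighbours different from itself.  This also makes
  the set of levels with a nonempty core finite, so that the maximum in the definition of the
  degeneracy is attained.\<close>

lemma less_of_min_degree_ge:
  assumes "G \<in> graphs n" "subgraph H G" "min_degree_ge k H" "verts H \<noteq> {}"
  shows "k < card (verts H)" "k < n"
proof -
  obtain v where v: "v \<in> verts H" using assms(4) by blast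
  have "k \<le> degree H v" using assms(3) v by (simp add: min_degree_ge_def)
  also have "degree H v < card (verts H)"
    using assms(2) v subgraph_finite[OF assms(1,2)]
    by (intro degree_less_card_verts) (auto simp: subgraph_def)
  finally show *: "k < card (verts H)" .
  also have "card (verts H) \<le> n"
    using card_mono[OF _ subgraph_finite(3)[OF assms(1,2)]] by simp
  finally show "k < n" .
qed

lemma core_levels_finite:
  assumes "G \<in> graphs n"
  shows "finite {k. verts (k_core k G) \<noteq> {}}"
proof (rule finite_subset)
  show "{k. verts (k_core k G) \<noteq> {}} \<subseteq> {..<n}"
    unfolding k_core_nonempty_iff[OF assms] using less_of_min_degree_ge(2)[OF assms] by blast
qed simp

lemma degen_ge:
  assumes "G \<in> graphs n" "subgraph H G" "min_degree_ge k H" "verts H \<noteq> {}"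
  shows "k \<le> degen G"
proof -
  have "verts (k_core k G) \<noteq> {}"
    unfolding k_core_nonempty_iff[OF assms(1)] by (intro exI[of _ H] conjI assms)
  then show ?thesis
    unfolding degen_def by (intro Max_ge core_levels_finite[OF assms(1)]) simp
qed

lemma degen_witness:
  assumes "G \<in> graphs n" "n > 0"
  obtains H where "subgraph H G" "min_degree_ge (degen G) H" "verts H \<noteq> {}"
proof -
  have "subgraph G G" "min_degree_ge 0 G" "verts G \<noteq> {}"
    using assms by (auto simp: subgraph_def graphs_iff min_degree_ge_def)
  then have "verts (k_core 0 G) \<noteq> {}"
    unfolding k_core_nonempty_iff[OF assms(1)] by (intro exI[of _ G] conjI)
  then have "degen G \<in> {k. verts (k_core k G) \<noteq> {}}"
    unfolding degen_def by (intro Max_in core_levels_finite[OF assms(1)]) auto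
  then have "\<exists>H. subgraph H G \<and> min_degree_ge (degen G) H \<and> verts H \<noteq> {}"
    using k_core_nonempty_iff[OF assms(1)] by simp
  then show thesis using that by (elim exE conjE)
qed

lemma degen_less:
  assumes "G \<in> graphs n" "n > 0"
  shows "degen G < n"
  by (rule degen_witness[OF assms]) (rule less_of_min_degree_ge(2)[OF assms(1)])

section \<open>Edge counts forced by the degeneracy\<close>

lemma handshake:
  assumes "edges H \<subseteq> all_edges (verts H)" "finite (verts H)"
  shows "(\<Sum>v\<in>verts H. degree H v) = 2 * card (edges H)"
proof -
  have fin: "finite (edges H)" using assms finite_all_edges finite_subset by blast
  have two: "card {v \<in> verts H. v \<in> e} = 2" if "e \<in> edges H" for e
  proof -
    have "{v \<in> verts H. v \<in> e} = e" "card e = 2"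
      using that assms(1) by (auto simp: all_edges_def)
    then show ?thesis by simp
  qed
  show ?thesis
    unfolding degree_def by (rule sum_multicount[OF assms(2) fin]) (use two in auto)
qed

text \<open>The innermost core has more than \<open>degen G\<close> vertices, each of degree at least
  \<open>degen G\<close>, so its edges alone are as many as those of a clique on \<open>degen G + 1\<close>
  vertices.\<close>

lemma edges_ge_of_degen:
  assumes "G \<in> graphs n" "n > 0"
  shows "degen G * (degen G + 1) \<le> 2 * card (edges G)"
proof -
  obtain H where H: "subgraph H G" "min_degree_ge (degen G) H" "verts H \<noteq> {}"
    using degen_witness[OF assms] .
  have "degen G * (degen G + 1) \<le> card (verts H) * degen G"
    using mult_le_mono1[of "degen G + 1" "card (verts H)" "degen G"]
      less_of_min_degree_ge(1)[OF assms(1) H] by (simp add: mult.commute)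
  also have "\<dots> \<le> (\<Sum>v\<in>verts H. degree H v)"
    using sum_bounded_below[of "verts H" "degen G" "degree H"] H(2)
    by (simp add: min_degree_ge_def)
  also have "\<dots> = 2 * card (edges H)"
    using H(1) subgraph_finite[OF assms(1) H(1)] by (intro handshake) (auto simp: subgraph_def)
  also have "\<dots> \<le> 2 * card (edges G)"
    using H(1) finite_subset[OF _ finite_all_edges, of "edges G" "{..<n}"] assms(1)
    by (auto simp: subgraph_def graphs_iff intro: card_mono)
  finally show ?thesis .
qed

text \<open>Vertices of degree at most \<open>D\<close> can be deleted one after another until \<open>D\<close> vertices are
  left; each deletion loses at most \<open>D\<close> edges, and the rest is at most a clique.\<close>

lemma edges_within_le:
  assumes low: "\<And>W. W \<subseteq> V \<Longrightarrow> W \<noteq> {} \<Longrightarrow> \<exists>v\<in>W. degree (W, E \<inter> all_edges W) v \<le> D"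
    and "finite W" "W \<subseteq> V" "D \<le> card W"
  shows "2 * card (E \<inter> all_edges W) + D * (D + 1) \<le> 2 * D * card W"
  using assms(2-4)
proof (induction "card W - D" arbitrary: W)
  case 0
  then have "card W = D" by simp
  have "card (E \<inter> all_edges W) \<le> card (all_edges W)"
    using 0 by (intro card_mono finite_all_edges) auto
  then have "real (card (E \<inter> all_edges W)) \<le> real (D choose 2)"
    using 0 \<open>card W = D\<close> by (simp add: card_all_edges)
  then have "real (2 * card (E \<inter> all_edges W) + D * (D + 1)) \<le> real (2 * D * card W)"
    using \<open>card W = D\<close> by (simp add: real_choose_two algebra_simps)
  then show ?case by (simp only: of_nat_le_iff)
next
  case (Suc m)
  then have "W \<noteq> {}" by auto
  then obtain v where v: "v \<in> W" "degree (W, E \<inter> all_edges W) v \<le> D"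
    using low Suc.prems by blast
  let ?W = "W - {v}"
  have card_W: "card W = Suc (card ?W)"
    using v Suc.prems by (intro card.remove)
  have IH: "2 * card (E \<inter> all_edges ?W) + D * (D + 1) \<le> 2 * D * card ?W"
    using Suc.hyps(2) Suc.prems card_W by (intro Suc.hyps(1)) auto
  have "E \<inter> all_edges W = (E \<inter> all_edges ?W) \<union> {e \<in> E \<inter> all_edges W. v \<in> e}"
    by (auto simp: all_edges_def)
  then have "card (E \<inter> all_edges W)
      \<le> card (E \<inter> all_edges ?W) + card {e \<in> E \<inter> all_edges W. v \<in> e}"
    by (metis card_Un_le)
  also have "\<dots> \<le> card (E \<inter> all_edges ?W) + D" using v by (simp add: degree_def)
  finally have "card (E \<inter> all_edges W) \<le> card (E \<inter> all_edges ?W) + D" .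
  then show ?case using IH card_W by simp
qed

text \<open>A set of vertices all of whose induced degrees exceed the degeneracy would induce a
  nonempty subgraph of too large minimum degree.\<close>

lemma edges_le_of_degen:
  assumes G: "G \<in> graphs n" and "n > 0"
  shows "2 * card (edges G) + degen G * (degen G + 1) \<le> 2 * degen G * n"
proof -
  have low: "\<exists>v\<in>W. degree (W, edges G \<inter> all_edges W) v \<le> degen G"
    if "W \<subseteq> {..<n}" "W \<noteq> {}" for W
  proof (rule ccontr)
    assume "\<not> ?thesis"
    then have "min_degree_ge (degen G + 1) (W, edges G \<inter> all_edges W)"
      by (auto simp: min_degree_ge_def not_le)
    moreover have "subgraph (W, edges G \<inter> all_edges W) G"
      using G that by (auto simp: subgraph_def graphs_iff)
    ultimately have "degen G + 1 \<le> degen G" using degen_ge[OF G] that by auto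
    then show False by simp
  qed
  have "2 * card (edges G \<inter> all_edges {..<n}) + degen G * (degen G + 1)
      \<le> 2 * degen G * card {..<n}"
    using degen_less[OF assms] by (intro edges_within_le[OF low]) auto
  then show ?thesis using G by (simp add: graphs_iff Int_absorb2)
qed

section \<open>The edge-degeneracy vectors lie in the limit region\<close>

lemma edge_degen_vec_eq:
  assumes "G \<in> graphs n"
  shows "edge_degen_vec G = (2 * real (card (edges G)) / (real n * (real n - 1)),
     real (degen G) / (real n - 1))"
  using assms by (simp add: edge_degen_vec_def graphs_iff real_choose_two)

text \<open>The two curves are the parabolas \<open>x = y\<^sup>2\<close> and \<open>1 - x = (1 - y)\<^sup>2\<close>, exchanged by
  the point reflection of the unit square.\<close>

lemma in_limit_regionI:
  assumes "0 \<le> y" "y \<le> 1" "y\<^sup>2 \<le> x" "(1 - y)\<^sup>2 \<le> 1 - x"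
  shows "(x, y) \<in> limit_region"
proof -
  have "0 \<le> x" using zero_le_power2 assms(3) by (rule order_trans)
  moreover have "0 \<le> 1 - x" using zero_le_power2 assms(4) by (rule order_trans)
  moreover have "1 - y \<le> sqrt (1 - x)" using assms by (intro real_le_rsqrt)
  moreover have "y \<le> sqrt x" using assms by (intro real_le_rsqrt)
  ultimately show ?thesis
    using assms by (auto simp: limit_region_def L_curve_def U_curve_def)
qed

lemma in_limit_regionD:
  assumes "(x, y) \<in> limit_region"
  shows "y\<^sup>2 \<le> x" "(1 - y)\<^sup>2 \<le> 1 - x"
proof -
  have *: "0 \<le> x" "x \<le> 1" "0 \<le> y" "y \<le> 1" "1 - y \<le> sqrt (1 - x)" "y \<le> sqrt x"
    using assms by (auto simp: limit_region_def L_curve_def U_curve_def)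
  show "y\<^sup>2 \<le> x" using * power_mono[of y "sqrt x" 2] by simp
  show "(1 - y)\<^sup>2 \<le> 1 - x" using * power_mono[of "1 - y" "sqrt (1 - x)" 2] by simp
qed

lemma curve_points_in_limit_region:
  assumes "0 \<le> c" "c \<le> 1"
  shows "(c\<^sup>2, c) \<in> limit_region" "(1 - c\<^sup>2, 1 - c) \<in> limit_region"
proof -
  have "c * c \<le> c" using assms by (intro mult_left_le_one_le) auto
  then have "(1 - c)\<^sup>2 \<le> 1 - c\<^sup>2" by (simp add: power2_eq_square algebra_simps)
  then show "(c\<^sup>2, c) \<in> limit_region" "(1 - c\<^sup>2, 1 - c) \<in> limit_region"
    using assms by (auto intro!: in_limit_regionI)
qed

text \<open>The edge bounds read \<open>(k / (N - 1)) ((k + 1) / N) \<le> x\<close> and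
  \<open>((N - 1 - k) / (N - 1)) ((N - k) / N) \<le> 1 - x\<close>.  In both products the second factor is at
  least the first one, because \<open>0 \<le> k \<le> N - 1\<close>, so both bounds survive when it is replaced
  by the first one, which is \<open>y\<close>, respectively \<open>1 - y\<close>.\<close>

lemma edge_degen_vec_in_limit_region:
  assumes G: "G \<in> graphs n" and n: "n \<ge> 2"
  shows "edge_degen_vec G \<in> limit_region"
proof -
  define N k E where "N = real n" and "k = real (degen G)" and "E = real (card (edges G))"
  have k: "0 \<le> k" "k \<le> N - 1" and N: "N \<ge> 2"
    using degen_less[OF G] n by (auto simp: N_def k_def)
  have "real (degen G * (degen G + 1)) \<le> real (2 * card (edges G))"
    using edges_ge_of_degen[OF G] n by (simp only: of_nat_le_iff)
  then have lo: "k * (k + 1) \<le> 2 * E" by (simp add: k_def E_def algebra_simps)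
  have "real (2 * card (edges G) + degen G * (degen G + 1)) \<le> real (2 * degen G * n)"
    using edges_le_of_degen[OF G] n by (simp only: of_nat_le_iff)
  then have hi: "2 * E + k * (k + 1) \<le> 2 * k * N"
    by (simp add: k_def E_def N_def algebra_simps)
  have pos: "0 < N * (N - 1)" "0 < N - 1" using N by auto
  have "(k / (N - 1))\<^sup>2 \<le> k * (k + 1) / (N * (N - 1))"
  proof -
    have "k * N \<le> (k + 1) * (N - 1)" using k by (simp add: algebra_simps)
    then have "k / (N - 1) \<le> (k + 1) / N" using N by (simp add: field_simps)
    then have "k / (N - 1) * (k / (N - 1)) \<le> k / (N - 1) * ((k + 1) / N)"
      using k N by (intro mult_left_mono) auto
    then show ?thesis by (simp add: power2_eq_square mult.commute)
  qed
  also have "\<dots> \<le> 2 * E / (N * (N - 1))" using lo pos by (intro divide_right_mono) auto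
  finally have 1: "(k / (N - 1))\<^sup>2 \<le> 2 * E / (N * (N - 1))" .
  have "(1 - k / (N - 1))\<^sup>2 = (N - 1 - k) / (N - 1) * ((N - 1 - k) / (N - 1))"
    using N by (simp add: power2_eq_square diff_divide_distrib)
  also have "\<dots> \<le> (N - 1 - k) / (N - 1) * ((N - k) / N)"
  proof (intro mult_left_mono)
    have "(N - 1 - k) * N \<le> (N - k) * (N - 1)" using k by (simp add: algebra_simps)
    then show "(N - 1 - k) / (N - 1) \<le> (N - k) / N" using N by (simp add: field_simps)
    show "0 \<le> (N - 1 - k) / (N - 1)" using k N by simp
  qed
  also have "\<dots> = ((N - 1 - k) * (N - k)) / (N * (N - 1))" by (simp add: mult.commute)
  also have "\<dots> \<le> (N * (N - 1) - 2 * E) / (N * (N - 1))"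
    using hi pos by (intro divide_right_mono) (auto simp: algebra_simps)
  also have "\<dots> = 1 - 2 * E / (N * (N - 1))" using pos by (simp add: diff_divide_distrib)
  finally have 2: "(1 - k / (N - 1))\<^sup>2 \<le> 1 - 2 * E / (N * (N - 1))" .
  have "(2 * E / (N * (N - 1)), k / (N - 1)) \<in> limit_region"
    using 1 2 k pos by (intro in_limit_regionI) auto
  then show ?thesis by (simp add: edge_degen_vec_eq[OF G] N_def k_def E_def)
qed

section \<open>Graphs close to the two boundary curves\<close>

definition clique_graph :: "nat \<Rightarrow> nat \<Rightarrow> graph" where
  "clique_graph n m = ({..<n}, all_edges {..<m})"

text \<open>The complement of the previous graph: \<open>n - m\<close> vertices joined to everything, and an
  independent set on the first \<open>m\<close> vertices.\<close>

definition co_clique_graph :: "nat \<Rightarrow> nat \<Rightarrow> graph" where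
  "co_clique_graph n m = ({..<n}, all_edges {..<n} - all_edges {..<m})"

lemma clique_graph_in_graphs: "m \<le> n \<Longrightarrow> clique_graph n m \<in> graphs n"
  by (auto simp: clique_graph_def graphs_iff all_edges_def)

lemma co_clique_graph_in_graphs: "co_clique_graph n m \<in> graphs n"
  by (auto simp: co_clique_graph_def graphs_iff)

lemma card_edges_clique_graph: "card (edges (clique_graph n m)) = m choose 2"
  by (simp add: clique_graph_def card_all_edges)

lemma card_edges_co_clique_graph:
  assumes "m \<le> n"
  shows "real (card (edges (co_clique_graph n m))) = real (n choose 2) - real (m choose 2)"
proof -
  have "all_edges {..<m} \<subseteq> all_edges {..<n}" using assms by (auto simp: all_edges_def)
  then have "card (all_edges {..<n} - all_edges {..<m}) = (n choose 2) - (m choose 2)"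
    by (simp add: card_Diff_subset finite_all_edges card_all_edges)
  moreover have "m choose 2 \<le> n choose 2" using assms by (rule binomial_right_mono)
  ultimately show ?thesis by (simp add: co_clique_graph_def of_nat_diff)
qed

lemma degen_clique_graph_ge:
  assumes "m \<le> n" "0 < m"
  shows "m - 1 \<le> degen (clique_graph n m)"
proof (rule degen_ge[OF clique_graph_in_graphs[OF assms(1)], where H = "({..<m}, all_edges {..<m})"])
  show "subgraph ({..<m}, all_edges {..<m}) (clique_graph n m)"
    using assms by (auto simp: subgraph_def clique_graph_def)
  show "min_degree_ge (m - 1) ({..<m}, all_edges {..<m})"
    unfolding min_degree_ge_def
  proof
    fix v assume "v \<in> verts ({..<m}, all_edges {..<m})"
    then have "v < m" by simp
    then have "{w. w \<noteq> v \<and> {v, w} \<in> all_edges {..<m}} = {..<m} - {v}"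
      by (auto simp: all_edges_def)
    then have "degree ({..<m}, all_edges {..<m}) v = m - 1"
      using \<open>v < m\<close> degree_eq_card_neighbours[of "({..<m}, all_edges {..<m})" "{..<m}" v]
      by simp
    then show "m - 1 \<le> degree ({..<m}, all_edges {..<m}) v" by simp
  qed
qed (use assms in auto)

text \<open>A vertex of the independent set only sees the \<open>n - m\<close> vertices outside it, and a
  subgraph avoiding the independent set has at most \<open>n - m\<close> vertices.\<close>

lemma degen_co_clique_graph_le:
  assumes "m \<le> n" "0 < n"
  shows "degen (co_clique_graph n m) \<le> n - m"
proof -
  let ?G = "co_clique_graph n m"
  obtain H where H: "subgraph H ?G" "min_degree_ge (degen ?G) H" "verts H \<noteq> {}"
    using degen_witness[OF co_clique_graph_in_graphs assms(2)] .
  note fin = subgraph_finite[OF co_clique_graph_in_graphs H(1)]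
  show ?thesis
  proof (cases "\<exists>v\<in>verts H. v < m")
    case True
    then obtain v where v: "v \<in> verts H" "v < m" by auto
    have "{w. w \<noteq> v \<and> {v, w} \<in> edges H} \<subseteq> {m..<n}"
      using H(1) v by (auto simp: subgraph_def co_clique_graph_def all_edges_def)
    then have "degree H v \<le> n - m"
      using degree_eq_card_neighbours[of H "verts H" v] H(1) card_mono[of "{m..<n}"]
      by (auto simp: subgraph_def)
    moreover have "degen ?G \<le> degree H v" using H(2) v by (simp add: min_degree_ge_def)
    ultimately show ?thesis by simp
  next
    case False
    then have "verts H \<subseteq> {m..<n}" using fin(3) by (auto simp: not_less dest: subsetD)
    then have "card (verts H) \<le> n - m" using card_mono[of "{m..<n}"] by auto
    then show ?thesis
      using less_of_min_degree_ge(1)[OF co_clique_graph_in_graphs H] by simp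
  qed
qed

lemma floor_fraction_tendsto:
  fixes c :: real
  assumes "0 \<le> c"
  shows "(\<lambda>n. real (nat \<lfloor>c * real n\<rfloor>) / real n) \<longlonglongrightarrow> c"
proof (rule tendsto_sandwich)
  have *: "c * real n - 1 \<le> real (nat \<lfloor>c * real n\<rfloor>)" "real (nat \<lfloor>c * real n\<rfloor>) \<le> c * real n" for n
    using assms by (simp_all add: of_nat_nat) linarith?
  show "\<forall>\<^sub>F n in sequentially. c - 1 / real n \<le> real (nat \<lfloor>c * real n\<rfloor>) / real n"
    using eventually_gt_at_top[of 0]
  proof eventually_elim
    case (elim n)
    have "(c * real n - 1) / real n \<le> real (nat \<lfloor>c * real n\<rfloor>) / real n"
      by (intro divide_right_mono *) simp
    then show ?case using elim by (simp add: diff_divide_distrib)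
  qed
  show "\<forall>\<^sub>F n in sequentially. real (nat \<lfloor>c * real n\<rfloor>) / real n \<le> c"
    using eventually_gt_at_top[of 0] by eventually_elim (use * in \<open>auto simp: field_simps\<close>)
  show "(\<lambda>n. c - 1 / real n) \<longlonglongrightarrow> c"
    using tendsto_diff[OF tendsto_const lim_1_over_n, of c] by simp
qed simp

lemma clique_sizes_of_fraction:
  fixes c :: real
  assumes "0 \<le> c" "c \<le> 1"
  obtains m :: "nat \<Rightarrow> nat"
  where "\<And>n. m n \<le> n" "(\<lambda>n. real (m n) / real n) \<longlonglongrightarrow> c"
proof
  show "nat \<lfloor>c * real n\<rfloor> \<le> n" for n
  proof -
    have "\<lfloor>c * real n\<rfloor> \<le> \<lfloor>real n\<rfloor>"
      using assms by (intro floor_mono mult_left_le_one_le) auto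
    then show ?thesis by (simp add: nat_le_iff)
  qed
  show "(\<lambda>n. real (nat \<lfloor>c * real n\<rfloor>) / real n) \<longlonglongrightarrow> c"
    by (rule floor_fraction_tendsto[OF assms(1)])
qed

text \<open>The first and the third limit are the coordinates for cliques; the second and one minus the
  third are those for their complements.\<close>

lemma clique_fraction_limits:
  fixes m :: "nat \<Rightarrow> nat"
  assumes "(\<lambda>n. real (m n) / real n) \<longlonglongrightarrow> c"
  shows "(\<lambda>n. (real (m n) - 1) / (real n - 1)) \<longlonglongrightarrow> c"
    and "(\<lambda>n. (real n - real (m n)) / (real n - 1)) \<longlonglongrightarrow> 1 - c"
    and "(\<lambda>n. real (m n) * (real (m n) - 1) / (real n * (real n - 1))) \<longlonglongrightarrow> c\<^sup>2"
proof -
  have inv: "(\<lambda>n. 1 / real n) \<longlonglongrightarrow> 0" by (rule lim_1_over_n)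
  have "(\<lambda>n. (real (m n) / real n - 1 / real n) / (1 - 1 / real n)) \<longlonglongrightarrow> (c - 0) / (1 - 0)"
    by (intro tendsto_intros assms inv) simp
  moreover have "\<forall>\<^sub>F n in sequentially. (real (m n) / real n - 1 / real n) / (1 - 1 / real n)
      = (real (m n) - 1) / (real n - 1)"
    using eventually_gt_at_top[of 1] by eventually_elim (simp add: field_simps)
  ultimately show 1: "(\<lambda>n. (real (m n) - 1) / (real n - 1)) \<longlonglongrightarrow> c"
    by (simp add: filterlim_cong)
  have "(\<lambda>n. 1 - (real (m n) - 1) / (real n - 1)) \<longlonglongrightarrow> 1 - c"
    by (intro tendsto_intros 1)
  moreover have "\<forall>\<^sub>F n in sequentially. 1 - (real (m n) - 1) / (real n - 1)
      = (real n - real (m n)) / (real n - 1)"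
    using eventually_gt_at_top[of 1] by eventually_elim (simp add: field_simps)
  ultimately show "(\<lambda>n. (real n - real (m n)) / (real n - 1)) \<longlonglongrightarrow> 1 - c"
    by (simp add: filterlim_cong)
  show "(\<lambda>n. real (m n) * (real (m n) - 1) / (real n * (real n - 1))) \<longlonglongrightarrow> c\<^sup>2"
    using tendsto_mult[OF assms 1] by (simp add: power2_eq_square)
qed

section \<open>Exposed points of the limit region\<close>

lemma compact_limit_region: "compact limit_region"
proof -
  have *: "limit_region = ({0..1} \<times> {0..1}) \<inter>
      ({p. L_curve (fst p) \<le> snd p} \<inter> {p. snd p \<le> U_curve (fst p)})"
    by (auto simp: limit_region_def)
  have "closed {p :: real \<times> real. L_curve (fst p) \<le> snd p}"
    "closed {p :: real \<times> real. snd p \<le> U_curve (fst p)}"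
    unfolding L_curve_def U_curve_def by (intro closed_Collect_le continuous_intros)+
  then show ?thesis
    unfolding * by (intro compact_Int_closed compact_Times closed_Int) auto
qed

text \<open>A unique maximizer of a nonzero functional is automatically on the frontier, since from an
  interior point one can still move in direction \<open>d\<close>.\<close>

lemma alpha_eqI:
  assumes "d \<noteq> 0" "p \<in> limit_region"
    and max: "\<And>q. q \<in> limit_region \<Longrightarrow> q \<noteq> p \<Longrightarrow> d \<bullet> q < d \<bullet> p"
  shows "alpha d = p"
  unfolding alpha_def
proof (rule the_equality)
  have "p \<notin> interior limit_region"
  proof
    assume "p \<in> interior limit_region"
    then obtain e where e: "e > 0" "cball p e \<subseteq> limit_region"
      by (auto simp: mem_interior_cball)
    define q where "q = p + (e / norm d) *\<^sub>R d"
    have "dist p q = e" using e assms(1) by (simp add: q_def dist_norm)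
    then have "q \<in> limit_region" "q \<noteq> p" using e by auto
    then have "d \<bullet> q < d \<bullet> p" by (rule max)
    moreover have "d \<bullet> q = d \<bullet> p + e / norm d * (d \<bullet> d)" by (simp add: q_def inner_add_right)
    moreover have "0 \<le> e / norm d * (d \<bullet> d)" using e by simp
    ultimately show False by simp
  qed
  then show "p \<in> frontier limit_region \<and> p \<in> limit_region \<and> (\<forall>q\<in>limit_region. d \<bullet> q \<le> d \<bullet> p)"
    using assms(2) max closure_subset[of limit_region] by (force simp: frontier_def less_imp_le)
  fix p' assume "p' \<in> frontier limit_region \<and> p' \<in> limit_region \<and> (\<forall>q\<in>limit_region. d \<bullet> q \<le> d \<bullet> p')"
  then show "p' = p" using max[of p'] assms(2) by force
qed

text \<open>Outside an open ball around \<open>p\<close> the set is still compact, so the functional attains its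
  maximum there, and this maximum is smaller than the value at \<open>p\<close>.\<close>

lemma exposed_point_gap:
  fixes p :: "'a::euclidean_space"
  assumes "compact K" and max: "\<And>q. q \<in> K \<Longrightarrow> q \<noteq> p \<Longrightarrow> d \<bullet> q < d \<bullet> p" and "\<eta> > 0"
  obtains \<gamma> where "\<gamma> < d \<bullet> p" "\<And>q. q \<in> K \<Longrightarrow> dist q p > \<eta> \<Longrightarrow> d \<bullet> q \<le> \<gamma>"
proof -
  let ?K = "K - ball p \<eta>"
  show thesis
  proof (cases "?K = {}")
    case True
    then have "\<not> dist q p > \<eta>" if "q \<in> K" for q using that by (auto simp: dist_commute)
    then show thesis using that[of "d \<bullet> p - 1"] by auto
  next
    case False
    have "compact ?K" using assms(1) by (intro compact_diff) auto
    then obtain q where q: "q \<in> ?K" "\<And>q'. q' \<in> ?K \<Longrightarrow> d \<bullet> q' \<le> d \<bullet> q"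
      using continuous_attains_sup[OF _ False, of "\<lambda>q. d \<bullet> q"]
      by (force intro: continuous_intros)
    have "d \<bullet> q < d \<bullet> p" using q(1) \<open>\<eta> > 0\<close> by (intro max) auto
    then show thesis using q(2) by (intro that[of "d \<bullet> q"]) (auto simp: dist_commute)
  qed
qed

section \<open>Concentration of the model along a ray\<close>

lemma measure_ed_model:
  assumes "S \<subseteq> graphs n"
  shows "measure (ed_model n \<theta>) S = (\<Sum>G\<in>S. ed_mass n \<theta> G)"
proof -
  have fin: "finite S" using assms finite_graphs by (rule finite_subset)
  have "emeasure (ed_model n \<theta>) S = ennreal (\<Sum>G\<in>S. ed_mass n \<theta> G)"
    unfolding ed_model_def
    by (subst emeasure_point_measure_finite2[OF assms fin])
      (auto simp: ed_mass_def intro!: sum_ennreal)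
  then show ?thesis by (simp add: measure_def sum_nonneg ed_mass_def)
qed

text \<open>Comparison with a single graph \<open>H\<close> bounds the mass of \<open>G\<close> without any knowledge of
  the normalizing constant, because the mass of \<open>H\<close> is at most one.\<close>

lemma ed_mass_le:
  assumes "H \<in> graphs n"
  shows "ed_mass n \<theta> G \<le> exp (\<theta> \<bullet> (edge_degen_vec G - edge_degen_vec H))"
proof -
  have "measure (ed_model n \<theta>) {H} \<le> 1" by (rule prob_space.prob_le_1[OF prob_space_ed_model])
  then have "ed_mass n \<theta> H \<le> 1" using assms by (simp add: measure_ed_model)
  then have "\<theta> \<bullet> edge_degen_vec H \<le> log_partition n \<theta>" by (simp add: ed_mass_def)
  then show ?thesis by (simp add: ed_mass_def inner_diff_right)
qed

text \<open>If \<open>H\<close> beats every graph outside \<open>S\<close> in direction \<open>d\<close>, each of the finitely many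
  graphs outside \<open>S\<close> has a mass that decays exponentially in \<open>r\<close>; the factor contributed by
  \<open>\<beta>\<close> does not depend on \<open>r\<close>.\<close>

lemma ray_concentration:
  assumes S: "S \<subseteq> graphs n" and H: "H \<in> graphs n" and "0 < \<epsilon>"
    and less: "\<And>G. G \<in> graphs n - S \<Longrightarrow> d \<bullet> edge_degen_vec G < d \<bullet> edge_degen_vec H"
  shows "\<exists>R::real. \<forall>r\<ge>R. measure (ed_model n (\<beta> + r *\<^sub>R d)) S \<ge> 1 - \<epsilon>"
proof -
  let ?t = "\<lambda>G. edge_degen_vec G - edge_degen_vec H"
  let ?f = "\<lambda>r. \<Sum>G\<in>graphs n - S. exp ((\<beta> + r *\<^sub>R d) \<bullet> ?t G)"
  have "((\<lambda>r. exp ((\<beta> + r *\<^sub>R d) \<bullet> ?t G)) \<longlongrightarrow> 0) at_top" if "G \<in> graphs n - S" for G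
  proof -
    have neg: "d \<bullet> ?t G < 0" using less[OF that] by (simp add: inner_diff_right)
    have "filterlim (\<lambda>r. \<beta> \<bullet> ?t G + (d \<bullet> ?t G) * r) at_bot at_top"
      by (intro filterlim_tendsto_add_at_bot_iff[THEN iffD2, OF tendsto_const]
          filterlim_tendsto_neg_mult_at_bot[OF tendsto_const neg] filterlim_ident)
    then show ?thesis
      by (auto simp: inner_add_left mult.commute intro: filterlim_compose[OF exp_at_bot])
  qed
  then have "(?f \<longlongrightarrow> (\<Sum>G\<in>graphs n - S. 0)) at_top" by (rule tendsto_sum)
  then have "\<forall>\<^sub>F r in at_top. ?f r < \<epsilon>"
    using order_tendstoD(2)[of ?f 0 at_top \<epsilon>] \<open>0 < \<epsilon>\<close> by simp
  then obtain R where R: "\<And>r. r \<ge> R \<Longrightarrow> ?f r < \<epsilon>" by (auto simp: eventually_at_top_linorder)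
  have "measure (ed_model n (\<beta> + r *\<^sub>R d)) S \<ge> 1 - \<epsilon>" if "r \<ge> R" for r
  proof -
    let ?M = "ed_model n (\<beta> + r *\<^sub>R d)"
    interpret prob_space ?M by (rule prob_space_ed_model)
    have sp: "space ?M = graphs n" "sets ?M = Pow (graphs n)"
      by (simp_all add: ed_model_def space_point_measure sets_point_measure)
    have "1 - measure ?M S = measure ?M (graphs n - S)"
      using prob_compl[of S] S sp by simp
    also have "\<dots> \<le> ?f r"
      by (subst measure_ed_model) (auto intro!: sum_mono ed_mass_le[OF H])
    finally show ?thesis using R[OF that] by linarith
  qed
  then show ?thesis by blast
qed

text \<open>The graphs \<open>H n\<close> approach the maximal value \<open>d \<bullet> p\<close>, so they eventually beat every
  point of the region outside the \<open>\<eta>\<close>-ball around \<open>p\<close>.  Only a lower bound \<open>g\<close> for the value of \<open>H n\<close>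
  is asked for; hence a one-sided estimate of the degeneracy of \<open>H n\<close> suffices in
  applications.\<close>

lemma concentration_at_exposed_point:
  assumes "d \<noteq> 0" "p \<in> limit_region"
    and max: "\<And>q. q \<in> limit_region \<Longrightarrow> q \<noteq> p \<Longrightarrow> d \<bullet> q < d \<bullet> p"
    and H: "\<And>n. H n \<in> graphs n"
    and lower: "\<And>n. n \<ge> 2 \<Longrightarrow> g n \<le> d \<bullet> edge_degen_vec (H n)" and g: "g \<longlonglongrightarrow> d \<bullet> p"
    and "0 < \<epsilon>" "0 < \<eta>"
  shows "\<exists>N\<ge>2. \<forall>n\<ge>N. \<exists>R::real. \<forall>r\<ge>R.
           measure (ed_model n (\<beta> + r *\<^sub>R d))
             {G \<in> graphs n. dist (edge_degen_vec G) (alpha d) \<le> \<eta>} \<ge> 1 - \<epsilon>"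
proof -
  have alpha: "alpha d = p" by (rule alpha_eqI[OF assms(1,2) max])
  obtain \<gamma> where \<gamma>: "\<gamma> < d \<bullet> p" "\<And>q. q \<in> limit_region \<Longrightarrow> dist q p > \<eta> \<Longrightarrow> d \<bullet> q \<le> \<gamma>"
    using exposed_point_gap[OF compact_limit_region max \<open>0 < \<eta>\<close>] by blast
  have "\<forall>\<^sub>F n in sequentially. \<gamma> < g n" using order_tendstoD(1)[OF g \<gamma>(1)] .
  then obtain N where N: "\<And>n. n \<ge> N \<Longrightarrow> \<gamma> < g n" by (auto simp: eventually_sequentially)
  have "\<exists>R::real. \<forall>r\<ge>R. measure (ed_model n (\<beta> + r *\<^sub>R d))
      {G \<in> graphs n. dist (edge_degen_vec G) (alpha d) \<le> \<eta>} \<ge> 1 - \<epsilon>" if "n \<ge> max 2 N" for n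
  proof (rule ray_concentration[OF _ H \<open>0 < \<epsilon>\<close>])
    fix G assume "G \<in> graphs n - {G \<in> graphs n. dist (edge_degen_vec G) (alpha d) \<le> \<eta>}"
    then have "d \<bullet> edge_degen_vec G \<le> \<gamma>"
      using that by (intro \<gamma>(2) edge_degen_vec_in_limit_region[of G n]) (auto simp: alpha)
    also have "\<gamma> < d \<bullet> edge_degen_vec (H n)" using N[of n] lower[of n] that by simp
    finally show "d \<bullet> edge_degen_vec G < d \<bullet> edge_degen_vec (H n)" .
  qed auto
  then show ?thesis by (intro exI[of _ "max 2 N"]) simp
qed

section \<open>The normal cones\<close>

lemma cone_gen_subset_halfspace:
  assumes "\<And>a. a \<in> A \<Longrightarrow> 0 \<le> c \<bullet> a"
  shows "cone_gen A \<subseteq> {x. 0 \<le> c \<bullet> x}"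
proof
  fix x assume "x \<in> cone_gen A"
  then obtain F k where x: "x = (\<Sum>a\<in>F. k a *\<^sub>R a)" "F \<subseteq> A" "\<forall>a\<in>F. 0 \<le> k a"
    unfolding cone_gen_def by blast
  have "0 \<le> (\<Sum>a\<in>F. k a * (c \<bullet> a))"
    using x(2,3) assms by (intro sum_nonneg mult_nonneg_nonneg) blast+
  then show "x \<in> {x. 0 \<le> c \<bullet> x}" by (simp add: x(1) inner_sum_right)
qed

lemma interior_cone_gen_inner_pos:
  assumes "d \<in> interior (cone_gen A)" "c \<noteq> 0" "\<And>a. a \<in> A \<Longrightarrow> 0 \<le> c \<bullet> a"
  shows "0 < c \<bullet> d"
proof -
  have "d \<in> interior {x. c \<bullet> x \<ge> 0}"
    using assms(1) interior_mono[OF cone_gen_subset_halfspace[OF assms(3)]] by auto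
  then show ?thesis using interior_halfspace_ge[OF assms(2)] by simp
qed

text \<open>The functionals \<open>\<plusminus> (0, 1)\<close> and \<open>\<plusminus> (2, 1)\<close> vanish on the boundary rays of the
  cones: \<open>(0, 1)\<close> on \<open>(\<plusminus>1, 0)\<close>, and \<open>(2, 1)\<close> on \<open>\<plusminus>(1, -2)\<close>.\<close>

lemma interior_cones:
  shows "(a, b) \<in> interior C_empty \<Longrightarrow> b < 0 \<and> 2 * a + b < 0"
    and "(a, b) \<in> interior C_complete \<Longrightarrow> b > 0 \<and> 2 * a + b > 0"
    and "(a, b) \<in> interior C_L \<Longrightarrow> b < 0 \<and> 2 * a + b > 0"
    and "(a, b) \<in> interior C_U \<Longrightarrow> b > 0 \<and> 2 * a + b < 0"
proof -
  have pos: "0 < c1 * a + c2 * b"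
    if "(a, b) \<in> interior (cone_gen {u, v})" "(c1, c2) \<noteq> (0, 0)"
      "0 \<le> (c1, c2) \<bullet> u" "0 \<le> (c1, c2) \<bullet> v" for u v and c1 c2 :: real
    using interior_cone_gen_inner_pos[OF that(1), of "(c1, c2)"] that(2-4)
    by (auto simp: zero_prod_def)
  show "b < 0 \<and> 2 * a + b < 0" if "(a, b) \<in> interior C_empty"
    using pos[OF that[unfolded C_empty_def], of 0 "-1"]
      pos[OF that[unfolded C_empty_def], of "-2" "-1"] by simp
  show "b > 0 \<and> 2 * a + b > 0" if "(a, b) \<in> interior C_complete"
    using pos[OF that[unfolded C_complete_def], of 0 1]
      pos[OF that[unfolded C_complete_def], of 2 1] by simp
  show "b < 0 \<and> 2 * a + b > 0" if "(a, b) \<in> interior C_L"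
    using pos[OF that[unfolded C_L_def], of 0 "-1"]
      pos[OF that[unfolded C_L_def], of 2 1] by simp
  show "b > 0 \<and> 2 * a + b < 0" if "(a, b) \<in> interior C_U"
    using pos[OF that[unfolded C_U_def], of 0 1]
      pos[OF that[unfolded C_U_def], of "-2" "-1"] by simp
qed

section \<open>The four regimes\<close>

text \<open>As \<open>x \<le> 2 y\<close> on the region and \<open>b < 0\<close>, the value \<open>a x + b y\<close> is at most
  \<open>(a + b / 2) x\<close>, which is negative as soon as the graph has an edge.\<close>

lemma concentration_empty:
  assumes ab: "b < 0" "2 * a + b < 0" and n: "n \<ge> 2" and "0 < \<epsilon>"
  shows "\<exists>R::real. \<forall>r\<ge>R. measure (ed_model n (\<beta> + r *\<^sub>R (a, b))) {empty_graph n} \<ge> 1 - \<epsilon>"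
proof (rule ray_concentration[OF _ empty_graph_in_graphs \<open>0 < \<epsilon>\<close>])
  have vec0: "edge_degen_vec (empty_graph n) = (0, 0)"
  proof -
    have "degen (empty_graph n) = 0"
      using edges_ge_of_degen[OF empty_graph_in_graphs[of n]] n by (simp add: empty_graph_def)
    then show ?thesis
      using edge_degen_vec_eq[OF empty_graph_in_graphs[of n]] by (simp add: empty_graph_def)
  qed
  fix G assume G: "G \<in> graphs n - {empty_graph n}"
  obtain x y where xy: "edge_degen_vec G = (x, y)" by fastforce
  have "finite (edges G)"
    using G finite_all_edges[of "{..<n}"] by (auto simp: graphs_iff intro: finite_subset)
  moreover have "edges G \<noteq> {}" using G by (cases G) (auto simp: graphs_iff empty_graph_def)
  ultimately have "x > 0"
    using xy G n edge_degen_vec_eq[of G n] by (auto simp: card_gt_0_iff)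
  have "(x, y) \<in> limit_region" using edge_degen_vec_in_limit_region[of G n] G n xy by simp
  from in_limit_regionD(2)[OF this] have "1 - 2 * y + y\<^sup>2 \<le> 1 - x"
    unfolding power2_diff by simp
  then have "x \<le> 2 * y" using zero_le_power2[of y] by linarith
  then have "b * (2 * y) \<le> b * x" using ab by (intro mult_left_mono_neg) auto
  moreover have "(2 * a + b) * x < 0" using ab \<open>x > 0\<close> by (simp add: mult_neg_pos)
  ultimately have "a * x + b * y < 0" by (simp add: algebra_simps)
  then show "(a, b) \<bullet> edge_degen_vec G < (a, b) \<bullet> edge_degen_vec (empty_graph n)"
    by (simp add: xy vec0 inner_prod_def)
qed (simp add: empty_graph_in_graphs)

text \<open>The mirror image: \<open>2 y \<le> 1 + x\<close> on the region and \<open>b > 0\<close>, so \<open>a x + b y\<close> falls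
  short of its value \<open>a + b\<close> at \<open>(1, 1)\<close> by at least \<open>(a + b / 2) (1 - x)\<close>.\<close>

lemma concentration_complete:
  assumes ab: "b > 0" "2 * a + b > 0" and n: "n \<ge> 2" and "0 < \<epsilon>"
  shows "\<exists>R::real. \<forall>r\<ge>R. measure (ed_model n (\<beta> + r *\<^sub>R (a, b))) {complete_graph n} \<ge> 1 - \<epsilon>"
proof (rule ray_concentration[OF _ complete_graph_in_graphs \<open>0 < \<epsilon>\<close>])
  have vec1: "edge_degen_vec (complete_graph n) = (1, 1)"
  proof -
    have "complete_graph n = clique_graph n n" by (simp add: complete_graph_def clique_graph_def)
    then have "degen (complete_graph n) = n - 1"
      using degen_clique_graph_ge[of n n] degen_less[OF complete_graph_in_graphs[of n]] n by simp
    then show ?thesis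
      using edge_degen_vec_eq[OF complete_graph_in_graphs[of n]] n
      by (simp add: complete_graph_def card_all_edges real_choose_two of_nat_diff)
  qed
  fix G assume G: "G \<in> graphs n - {complete_graph n}"
  obtain x y where xy: "edge_degen_vec G = (x, y)" by fastforce
  have "edges G \<subset> all_edges {..<n}"
    using G by (cases G) (auto simp: graphs_iff complete_graph_def)
  then have "card (edges G) < n choose 2"
    using psubset_card_mono[OF finite_all_edges, of "{..<n}"] by (simp add: card_all_edges)
  then have "2 * real (card (edges G)) < real n * (real n - 1)"
    using real_choose_two[of n] by (simp flip: of_nat_less_iff[where 'a = real])
  then have "x < 1" using xy G n edge_degen_vec_eq[of G n] by auto
  have "(x, y) \<in> limit_region" using edge_degen_vec_in_limit_region[of G n] G n xy by simp
  from in_limit_regionD(1)[OF this] have "2 * y \<le> 1 + x"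
    using zero_le_power2[of "1 - y"] unfolding power2_diff by simp
  then have "b * (2 * y) \<le> b * (1 + x)" using ab by (intro mult_left_mono) auto
  moreover have "(2 * a + b) * (x - 1) < 0" using ab \<open>x < 1\<close> by (simp add: mult_pos_neg)
  ultimately have "a * x + b * y < a + b" by (simp add: algebra_simps)
  then show "(a, b) \<bullet> edge_degen_vec G < (a, b) \<bullet> edge_degen_vec (complete_graph n)"
    by (simp add: xy vec1 inner_prod_def)
qed (simp add: complete_graph_in_graphs)

text \<open>Completing the square: the right-hand side minus the left-hand side is
  \<open>a ((z - s\<^sup>2) + (s - c)\<^sup>2)\<close>.  Both curves are covered, the upper one with
  \<open>(z, s) = (x, y)\<close> and the lower one with \<open>(z, s) = (1 - x, 1 - y)\<close>.\<close>

lemma parabola_exposed: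
  fixes a c s z :: real
  assumes "a > 0" "s\<^sup>2 \<le> z" "(z, s) \<noteq> (c\<^sup>2, c)"
  shows "2 * a * c * s - a * z < 2 * a * c * c - a * c\<^sup>2"
proof -
  have "0 < (z - s\<^sup>2) + (s - c)\<^sup>2"
  proof (cases "s = c")
    case True then show ?thesis using assms by auto
  next
    case False then show ?thesis using assms by (simp add: add_nonneg_pos)
  qed
  then have "0 < a * ((z - s\<^sup>2) + (s - c)\<^sup>2)" using assms(1) by simp
  then show ?thesis by (simp add: power2_eq_square algebra_simps)
qed

text \<open>Maximizing \<open>a y\<^sup>2 + b y\<close> gives the point \<open>(c\<^sup>2, c)\<close> of the upper curve with
  \<open>c = - b / (2 a)\<close>; the sign conditions give \<open>0 < c < 1\<close>.  It is
  approximated by cliques on about \<open>c n\<close> of the vertices.\<close>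

lemma concentration_upper:
  assumes ab: "b > 0" "2 * a + b < 0" and "0 < \<epsilon>" "0 < \<eta>"
  shows "\<exists>N\<ge>2. \<forall>n\<ge>N. \<exists>R::real. \<forall>r\<ge>R.
           measure (ed_model n (\<beta> + r *\<^sub>R (a, b)))
             {G \<in> graphs n. dist (edge_degen_vec G) (alpha (a, b)) \<le> \<eta>} \<ge> 1 - \<epsilon>"
proof -
  define c where "c = - b / (2 * a)"
  have a: "a < 0" using ab by simp
  have c: "0 < c" "c < 1" and b: "b = - 2 * a * c"
    using ab a by (auto simp: c_def field_simps)
  obtain m where m_le: "\<And>n. m n \<le> n" and lim: "(\<lambda>n. real (m n) / real n) \<longlonglongrightarrow> c"
    using clique_sizes_of_fraction[of c] c by auto
  note lims = clique_fraction_limits[OF lim]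
  let ?g = "\<lambda>n. a * (real (m n) * (real (m n) - 1) / (real n * (real n - 1)))
    + b * ((real (m n) - 1) / (real n - 1))"
  show ?thesis
  proof (rule concentration_at_exposed_point[OF _ _ _ _ _ _ \<open>0 < \<epsilon>\<close> \<open>0 < \<eta>\<close>])
    show "(a, b) \<noteq> 0" using a by (simp add: zero_prod_def)
    show "(c\<^sup>2, c) \<in> limit_region" using c by (intro curve_points_in_limit_region) auto
    show "(a, b) \<bullet> q < (a, b) \<bullet> (c\<^sup>2, c)" if q: "q \<in> limit_region" "q \<noteq> (c\<^sup>2, c)" for q
    proof -
      obtain z s where zs: "q = (z, s)" by fastforce
      have "2 * (- a) * c * s - (- a) * z < 2 * (- a) * c * c - (- a) * c\<^sup>2"
        using q a in_limit_regionD(1)[of z s] by (intro parabola_exposed) (auto simp: zs)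
      then show ?thesis by (simp add: zs b inner_prod_def)
    qed
    show "clique_graph n (m n) \<in> graphs n" for n by (rule clique_graph_in_graphs[OF m_le])
    show "?g n \<le> (a, b) \<bullet> edge_degen_vec (clique_graph n (m n))" if n: "n \<ge> 2" for n
    proof -
      \<comment> \<open>For \<open>m n = 0\<close> there is no clique, but then the left-hand side is negative.\<close>
      have "real (m n) - 1 \<le> real (degen (clique_graph n (m n)))"
        using degen_clique_graph_ge[OF m_le, of n] by (cases "m n = 0") linarith+
      then have "b * ((real (m n) - 1) / (real n - 1))
          \<le> b * (real (degen (clique_graph n (m n))) / (real n - 1))"
        using ab n by (intro mult_left_mono divide_right_mono) auto
      then show ?thesis
        by (simp add: edge_degen_vec_eq[OF clique_graph_in_graphs[OF m_le]] inner_prod_def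
            card_edges_clique_graph real_choose_two)
    qed
    have "?g \<longlonglongrightarrow> a * c\<^sup>2 + b * c" by (intro tendsto_intros lims)
    then show "?g \<longlonglongrightarrow> (a, b) \<bullet> (c\<^sup>2, c)" by (simp add: inner_prod_def)
  qed
qed

text \<open>With \<open>s = 1 - y\<close> one has \<open>x \<le> 1 - s\<^sup>2\<close> on the region, and the bound
  \<open>a (1 - s\<^sup>2) + b (1 - s)\<close> is maximal at \<open>s = c\<close> with \<open>c = - b / (2 a)\<close>, again in
  \<open>(0, 1)\<close>.  The approximating graphs are the complements of cliques on about \<open>c n\<close>
  vertices.\<close>

lemma concentration_lower:
  assumes ab: "b < 0" "2 * a + b > 0" and "0 < \<epsilon>" "0 < \<eta>"
  shows "\<exists>N\<ge>2. \<forall>n\<ge>N. \<exists>R::real. \<forall>r\<ge>R.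
           measure (ed_model n (\<beta> + r *\<^sub>R (a, b)))
             {G \<in> graphs n. dist (edge_degen_vec G) (alpha (a, b)) \<le> \<eta>} \<ge> 1 - \<epsilon>"
proof -
  define c where "c = - b / (2 * a)"
  have a: "a > 0" using ab by simp
  have c: "0 < c" "c < 1" and b: "b = - 2 * a * c"
    using ab a by (auto simp: c_def field_simps)
  obtain m where m_le: "\<And>n. m n \<le> n" and lim: "(\<lambda>n. real (m n) / real n) \<longlonglongrightarrow> c"
    using clique_sizes_of_fraction[of c] c by auto
  note lims = clique_fraction_limits[OF lim]
  let ?p = "(1 - c\<^sup>2, 1 - c)"
  let ?g = "\<lambda>n. a * (1 - real (m n) * (real (m n) - 1) / (real n * (real n - 1)))
    + b * ((real n - real (m n)) / (real n - 1))"
  show ?thesis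
  proof (rule concentration_at_exposed_point[OF _ _ _ _ _ _ \<open>0 < \<epsilon>\<close> \<open>0 < \<eta>\<close>])
    show "(a, b) \<noteq> 0" using a by (simp add: zero_prod_def)
    show "?p \<in> limit_region" using c by (intro curve_points_in_limit_region) auto
    show "(a, b) \<bullet> q < (a, b) \<bullet> ?p" if q: "q \<in> limit_region" "q \<noteq> ?p" for q
    proof -
      obtain x y where xy: "q = (x, y)" by fastforce
      have "2 * a * c * (1 - y) - a * (1 - x) < 2 * a * c * c - a * c\<^sup>2"
        using q a in_limit_regionD(2)[of x y] by (intro parabola_exposed) (auto simp: xy)
      then show ?thesis by (simp add: xy b inner_prod_def algebra_simps)
    qed
    show "co_clique_graph n (m n) \<in> graphs n" for n by (rule co_clique_graph_in_graphs)
    show "?g n \<le> (a, b) \<bullet> edge_degen_vec (co_clique_graph n (m n))" if n: "n \<ge> 2" for n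
    proof -
      have "real (degen (co_clique_graph n (m n))) \<le> real n - real (m n)"
        using degen_co_clique_graph_le[OF m_le, of n] n m_le[of n] by linarith
      then have "b * ((real n - real (m n)) / (real n - 1))
          \<le> b * (real (degen (co_clique_graph n (m n))) / (real n - 1))"
        using ab n by (intro mult_left_mono_neg divide_right_mono) auto
      moreover have "2 * real (card (edges (co_clique_graph n (m n)))) / (real n * (real n - 1))
          = 1 - real (m n) * (real (m n) - 1) / (real n * (real n - 1))"
        using n by (simp add: card_edges_co_clique_graph[OF m_le] real_choose_two field_simps)
      ultimately show ?thesis
        by (simp add: edge_degen_vec_eq[OF co_clique_graph_in_graphs] inner_prod_def)
    qed
    have "?g \<longlonglongrightarrow> a * (1 - c\<^sup>2) + b * (1 - c)" by (intro tendsto_intros lims)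
    then show "?g \<longlonglongrightarrow> (a, b) \<bullet> ?p" by (simp add: inner_prod_def)
  qed
qed

theorem theorem5p1:
  fixes d :: "real \<times> real"
  assumes "d \<noteq> 0"
  shows
    "(d \<in> interior C_empty \<longrightarrow>
        (\<forall>\<beta>. \<forall>\<epsilon>\<in>{0<..<1}. \<exists>N\<ge>2. \<forall>n\<ge>N. \<exists>R::real. \<forall>r\<ge>R.
           measure (ed_model n (\<beta> + r *\<^sub>R d)) {empty_graph n} \<ge> 1 - \<epsilon>))
   \<and> (d \<in> interior C_complete \<longrightarrow>
        (\<forall>\<beta>. \<forall>\<epsilon>\<in>{0<..<1}. \<exists>N\<ge>2. \<forall>n\<ge>N. \<exists>R::real. \<forall>r\<ge>R.
           measure (ed_model n (\<beta> + r *\<^sub>R d)) {complete_graph n} \<ge> 1 - \<epsilon>))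
   \<and> (d \<in> interior C_L \<longrightarrow>
        (\<forall>\<beta>. \<forall>\<epsilon>\<in>{0<..<1}. \<forall>\<eta>\<in>{0<..<1}. \<exists>N\<ge>2. \<forall>n\<ge>N. \<exists>R::real. \<forall>r\<ge>R.
           measure (ed_model n (\<beta> + r *\<^sub>R d))
             {G \<in> graphs n. dist (edge_degen_vec G) (alpha d) \<le> \<eta>} \<ge> 1 - \<epsilon>))
   \<and> (d \<in> interior C_U \<longrightarrow>
        (\<forall>\<beta>. \<forall>\<epsilon>\<in>{0<..<1}. \<forall>\<eta>\<in>{0<..<1}. \<exists>N\<ge>2. \<forall>n\<ge>N. \<exists>R::real. \<forall>r\<ge>R.
           measure (ed_model n (\<beta> + r *\<^sub>R d))
             {G \<in> graphs n. dist (edge_degen_vec G) (alpha d) \<le> \<eta>} \<ge> 1 - \<epsilon>))"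
proof (cases d)
  case (Pair a b)
  show ?thesis
    unfolding Pair
  proof (intro conjI impI allI ballI)
    fix \<beta> :: "real \<times> real" and \<epsilon> :: real assume "\<epsilon> \<in> {0<..<1}"
    then have \<epsilon>: "0 < \<epsilon>" by simp
    show "\<exists>N\<ge>2. \<forall>n\<ge>N. \<exists>R::real. \<forall>r\<ge>R.
        measure (ed_model n (\<beta> + r *\<^sub>R (a, b))) {empty_graph n} \<ge> 1 - \<epsilon>"
      if "(a, b) \<in> interior C_empty"
      using concentration_empty[OF _ _ _ \<epsilon>] interior_cones(1)[OF that] by blast
    show "\<exists>N\<ge>2. \<forall>n\<ge>N. \<exists>R::real. \<forall>r\<ge>R.
        measure (ed_model n (\<beta> + r *\<^sub>R (a, b))) {complete_graph n} \<ge> 1 - \<epsilon>"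
      if "(a, b) \<in> interior C_complete"
      using concentration_complete[OF _ _ _ \<epsilon>] interior_cones(2)[OF that] by blast
    fix \<eta> :: real assume "\<eta> \<in> {0<..<1}"
    then have \<eta>: "0 < \<eta>" by simp
    show "\<exists>N\<ge>2. \<forall>n\<ge>N. \<exists>R::real. \<forall>r\<ge>R. measure (ed_model n (\<beta> + r *\<^sub>R (a, b)))
        {G \<in> graphs n. dist (edge_degen_vec G) (alpha (a, b)) \<le> \<eta>} \<ge> 1 - \<epsilon>"
      if "(a, b) \<in> interior C_L"
      using interior_cones(3)[OF that] by (intro concentration_lower \<epsilon> \<eta>) simp_all
    show "\<exists>N\<ge>2. \<forall>n\<ge>N. \<exists>R::real. \<forall>r\<ge>R. measure (ed_model n (\<beta> + r *\<^sub>R (a, b)))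
        {G \<in> graphs n. dist (edge_degen_vec G) (alpha (a, b)) \<le> \<eta>} \<ge> 1 - \<epsilon>"
      if "(a, b) \<in> interior C_U"
      using interior_cones(4)[OF that] by (intro concentration_upper \<epsilon> \<eta>) simp_all
  qed
qed

end
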